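(* Let $\mathbb{L}$ be a Dedekind complete unital $f$-algebra, let $(S,\Sigma)$ be a measurable space, and let $\mu$ be a finite $\mathbb{L}$-valued measure on $(S,\Sigma)$ that is $\sigma$-scalar. Assume that the order continuous (real-valued) linear functionals on $\mathbb{L}_1$ separate the points of $\mathbb{L}_1$. Then $\mu$ is proper.
   Context: $\mathbb{L}$ has multiplicative unit $1$; $\mathbb{L}_1$ is the order ideal of $\mathbb{L}$ generated by $1$. A finite $\mathbb{L}$-valued measure on $(S,\Sigma)$ is a map $\mu:\Sigma\to\mathbb{L}^+$ with $\mu(\emptyset)=0$ and $\mu(\bigcup_{n}A_n)=\sum_{n=1}^\infty\mu(A_n)$ for every disjoint sequence $(A_n)$ in $\Sigma$. Sums of (possibly uncountable) families of positive elements are taken in the order sense: $\sum_{j\in J}\lambda_j$ is the supremum of all finite partial sums. $\mu$ is $\sigma$-scalar if $\mu(\Sigma)\subseteq\mathbb{L}_1$ and there exist a (possibly uncountable) family $\{m_j\}_{j\in J}$ of positive real-valued measures on $(S,\Sigma)$ and a family $\{\lambda_j\}_{j\in J}$ in $\mathbb{L}_1^+$ such that $\mu(A)=\sum_{j\in J}m_j(A)\lambda_j$ in $\mathbb{L}_1$ for every $A\in\Sigma$. A measurable step function is a function $\phi:S\to\mathbb{L}$ with finite range $\{\lambda_1,\dots,\lambda_n\}$ such that $A_i:=\phi^{-1}(\lambda_i)\in\Sigma$ for each $i$; its integral is $\int_S\phi\,\mathrm{d}\mu:=\sum_{i=1}^n\lambda_i\mu(A_i)$. $\mathcal{S}(S,\Sigma;\mathbb{L}_1^+)$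 is the set of measurable step functions with values in $\mathbb{L}_1^+$. $\mu$ is proper if for every sequence $(\varphi_n)$ in $\mathcal{S}(S,\Sigma;\mathbb{L}_1^+)$ with $\varphi_n\downarrow 0$ pointwise (i.e. for every $s\in S$, $(\varphi_n(s))$ is decreasing with infimum $0$ in $\mathbb{L}$), one has $\int_S\varphi_n\,\mathrm{d}\mu\downarrow 0$ in $\mathbb{L}$. *)

theory Defs
  imports
    "HOL-Analysis.Analysis"
    "HOL-Library.Lattice_Algebras"
    "HOL-Library.Lub_Glb"
begin

(* Neither commutativity nor 1 \<noteq> 0 is imposed. That products of positive elements are
   positive is part of ordered_ring, and abs x = sup x (- x) part of lattice_ring.
   Dedekind completeness is added by the sort conditionally_complete_lattice. *)
class unital_f_algebra = lattice_ring + real_algebra + monoid_mult + ordered_real_vector +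
  assumes f_algebra_left: "inf x y = 0 \<Longrightarrow> 0 \<le> z \<Longrightarrow> inf (z * x) y = 0"
    and f_algebra_right: "inf x y = 0 \<Longrightarrow> 0 \<le> z \<Longrightarrow> inf (x * z) y = 0"

definition order_ideal :: "'l::{real_vector, lattice_ab_group_add_abs} set \<Rightarrow> bool"
  where "order_ideal I \<longleftrightarrow>
    subspace I \<and> (\<forall>x y. y \<in> I \<longrightarrow> \<bar>x\<bar> \<le> \<bar>y\<bar> \<longrightarrow> x \<in> I)"

definition unit_ideal :: "'l::unital_f_algebra set"
  where "unit_ideal = order_ideal hull {1}"

definition unit_ideal_pos :: "'l::unital_f_algebra set"
  where "unit_ideal_pos = {x \<in> unit_ideal. 0 \<le> x}"

(* x is the sum in E, in the order sense, of a family of positive elements of E. *)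
definition has_order_sum_in ::
    "'l::{comm_monoid_add, ord} set \<Rightarrow> ('j \<Rightarrow> 'l) \<Rightarrow> 'j set \<Rightarrow> 'l \<Rightarrow> bool"
  where "has_order_sum_in E f J x \<longleftrightarrow> isLub E {sum f F | F. finite F \<and> F \<subseteq> J} x"

(* A measurable space is given by the components space M and sets M of M; the measure that the
   type also carries is never used. *)
definition vector_measure ::
    "'s measure \<Rightarrow> ('s set \<Rightarrow> 'l::{comm_monoid_add, ord}) \<Rightarrow> bool"
  where "vector_measure M \<mu> \<longleftrightarrow>
    (\<forall>A\<in>sets M. 0 \<le> \<mu> A) \<and> \<mu> {} = 0 \<and>
    (\<forall>A :: nat \<Rightarrow> 's set. range A \<subseteq> sets M \<longrightarrow> disjoint_family A \<longrightarrow>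
      has_order_sum_in UNIV (\<lambda>n. \<mu> (A n)) UNIV (\<mu> (\<Union>n. A n)))"

(* HOL cannot quantify over the types of index sets inside a formula, so the type of the indices
   is a parameter. A theorem with hypothesis sigma_scalar TYPE('j) M \<mu> for a type variable 'j
   covers families over arbitrary index sets. *)
definition sigma_scalar ::
    "'j itself \<Rightarrow> 's measure \<Rightarrow> ('s set \<Rightarrow> 'l::unital_f_algebra) \<Rightarrow> bool"
  where "sigma_scalar _ M \<mu> \<longleftrightarrow>
    \<mu> ` sets M \<subseteq> unit_ideal \<and>
    (\<exists>(J :: 'j set) (m :: 'j \<Rightarrow> 's measure) (lam :: 'j \<Rightarrow> 'l).
      (\<forall>j\<in>J. finite_measure (m j) \<and> space (m j) = space M \<and> sets (m j) = sets M) \<and>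
      (\<forall>j\<in>J. lam j \<in> unit_ideal_pos) \<and>
      (\<forall>A\<in>sets M. has_order_sum_in unit_ideal (\<lambda>j. measure (m j) A *\<^sub>R lam j) J (\<mu> A)))"

definition step_functions :: "'s measure \<Rightarrow> 'l set \<Rightarrow> ('s \<Rightarrow> 'l) set"
  where "step_functions M V = {\<phi>. simple_function M \<phi> \<and> \<phi> ` space M \<subseteq> V}"

definition step_integral ::
    "'s measure \<Rightarrow> ('s set \<Rightarrow> 'l) \<Rightarrow> ('s \<Rightarrow> 'l::semiring_0) \<Rightarrow> 'l"
  where "step_integral M \<mu> \<phi> = (\<Sum>v\<in>\<phi> ` space M. v * \<mu> (\<phi> -` {v} \<inter> space M))"

definition decreases_to_zero :: "(nat \<Rightarrow> 'l::{zero, order}) \<Rightarrow> bool"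
  where "decreases_to_zero x \<longleftrightarrow> decseq x \<and> isGlb UNIV (range x) 0"

definition proper_measure :: "'s measure \<Rightarrow> ('s set \<Rightarrow> 'l::unital_f_algebra) \<Rightarrow> bool"
  where "proper_measure M \<mu> \<longleftrightarrow>
    (\<forall>\<phi> :: nat \<Rightarrow> 's \<Rightarrow> 'l.
      (\<forall>n. \<phi> n \<in> step_functions M unit_ideal_pos) \<longrightarrow>
      (\<forall>s\<in>space M. decreases_to_zero (\<lambda>n. \<phi> n s)) \<longrightarrow>
      decreases_to_zero (\<lambda>n. step_integral M \<mu> (\<phi> n)))"

(* Order convergence to 0 in the Riesz subspace E. Filters on E stand for nets in E: a net
   corresponds to the filter of sets in which it eventually lies, and every filter arises from
   a net. The net condition reads: there is a net y decreasing to 0 such that for every b one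
   has \<bar>x a\<bar> \<le> y b for all sufficiently large a; D is the range of y. *)
definition order_null :: "'l::lattice_ab_group_add_abs set \<Rightarrow> 'l filter \<Rightarrow> bool"
  where "order_null E F \<longleftrightarrow>
    eventually (\<lambda>x. x \<in> E) F \<and>
    (\<exists>D. D \<subseteq> E \<and> D \<noteq> {} \<and> (\<forall>a\<in>D. \<forall>b\<in>D. \<exists>c\<in>D. c \<le> a \<and> c \<le> b) \<and> isGlb E D 0 \<and>
      (\<forall>d\<in>D. eventually (\<lambda>x. \<bar>x\<bar> \<le> d) F))"

(* Functionals on E are represented by functions on the whole type; values off E are irrelevant. *)
definition order_continuous_functional ::
    "'l::{real_vector, lattice_ab_group_add_abs} set \<Rightarrow> ('l \<Rightarrow> real) \<Rightarrow> bool"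
  where "order_continuous_functional E f \<longleftrightarrow>
    (\<forall>x\<in>E. \<forall>y\<in>E. f (x + y) = f x + f y) \<and>
    (\<forall>c. \<forall>x\<in>E. f (c *\<^sub>R x) = c * f x) \<and>
    (\<forall>F. order_null E F \<longrightarrow> (f \<longlongrightarrow> 0) F)"

definition order_continuous_functionals_separate ::
    "'l::{real_vector, lattice_ab_group_add_abs} set \<Rightarrow> bool"
  where "order_continuous_functionals_separate E \<longleftrightarrow>
    (\<forall>x\<in>E. \<forall>y\<in>E. x \<noteq> y \<longrightarrow> (\<exists>f. order_continuous_functional E f \<and> f x \<noteq> f y))"

end

theory Submission
  imports Defs
begin

text \<open>
  For a single real measure m, the integrals of step functions decreasing to 0 decrease to some
  p, and an order continuous functional f satisfies f(p) = 0: it commutes with the integral of a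
  step function, and f is bounded on order intervals, so dominated convergence applies to the
  functions f \<circ> \<phi> n. Since such f separate points, p = 0.

  In general, split \<mu> into the partial sum \<nu> over a finite F and a positive remainder. As all \<phi> n
  lie below some c1, any positive lower bound y of the integrals satisfies
  y \<le> c (\<mu>(S) - \<nu>(S)). Taking the infimum over F gives y \<le> 0.
\<close>

section \<open>The unit of an f-algebra and the order ideal it generates\<close>

text \<open>The f-algebra axioms are applied to one factor at a time: multiplying \<open>x\<close>
  by \<open>y\<close> keeps it disjoint from \<open>y\<close>, and then multiplying \<open>y\<close>
  by \<open>x\<close> makes \<open>x * y\<close> disjoint from itself.\<close>

lemma f_algebra_mult_eq_0:
  fixes x y :: "'l::unital_f_algebra"
  assumes "inf x y = 0"
  shows "x * y = 0"
proof -
  have x: "0 \<le> x" and y: "0 \<le> y"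
    using assms by (metis inf_le1, metis inf_le2)
  have "inf (x * y) y = 0"
    using f_algebra_right[OF assms y] .
  then have "inf y (x * y) = 0"
    by (simp add: inf_commute)
  from f_algebra_left[OF this x] show ?thesis
    by simp
qed

text \<open>The unit is a sum of squares: with \<open>p\<close> and \<open>q\<close> its positive
  and negative parts, disjointness kills the cross terms in \<open>(p - q) * (p - q)\<close>,
  leaving \<open>1 = p * p + q * q\<close>.\<close>

lemma f_algebra_one_ge_zero: "(0::'l::unital_f_algebra) \<le> 1"
proof -
  define p :: 'l where "p = sup 1 0"
  define q :: 'l where "q = sup (- 1) 0"
  have q: "q = - inf 1 0"
    unfolding q_def neg_inf_eq_sup by simp
  then have one: "1 = p - q"
    using prts[of "1::'l"] unfolding p_def pprt_def nprt_def by simp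
  \<comment> \<open>Translation by \<open>q\<close>, since \<open>p = 1 + q\<close> and
    \<open>q = 0 + q\<close>.\<close>
  have "inf p q = inf 1 0 + q"
    unfolding add_inf_distrib_right by (simp add: one)
  also have "\<dots> = 0"
    by (subst q) (rule right_minus)
  finally have d: "inf p q = 0" .
  then have "p * q = 0" and "q * p = 0"
    using f_algebra_mult_eq_0[of p q] f_algebra_mult_eq_0[of q p] by (simp_all add: inf_commute)
  moreover have "1 = (p - q) * (p - q)"
    by (simp flip: one)
  ultimately have "1 = p * p + q * q"
    by (simp add: algebra_simps)
  moreover have "0 \<le> p * p" "0 \<le> q * q"
    unfolding p_def q_def by simp_all
  ultimately show ?thesis
    using add_nonneg_nonneg[of "p * p" "q * q"] by simp
qed

lemma order_ideal_unit_ideal: "order_ideal (unit_ideal :: 'l::unital_f_algebra set)"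
  unfolding unit_ideal_def
proof (rule hull_in)
  fix T :: "'l set set"
  assume "\<forall>s\<in>T. order_ideal s"
  then show "order_ideal (\<Inter> T)"
    unfolding order_ideal_def by (auto intro!: subspace_Inter)
qed

lemmas subspace_unit_ideal = order_ideal_unit_ideal[unfolded order_ideal_def, THEN conjunct1]

lemma unit_ideal_absD: "y \<in> unit_ideal \<Longrightarrow> \<bar>x\<bar> \<le> \<bar>y\<bar> \<Longrightarrow> x \<in> unit_ideal"
  using order_ideal_unit_ideal unfolding order_ideal_def by blast

lemma unit_ideal_downD: "y \<in> unit_ideal \<Longrightarrow> 0 \<le> x \<Longrightarrow> x \<le> y \<Longrightarrow> x \<in> unit_ideal"
  using unit_ideal_absD[of y x] by (simp add: abs_of_nonneg)

text \<open>The elements dominated in absolute value by a multiple of the unit form an order ideal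
  containing \<open>1\<close>, so the generated ideal is contained in it. The multiple is kept
  strictly positive so that it can be inverted later.\<close>

lemma unit_ideal_boundedE:
  fixes x :: "'l::unital_f_algebra"
  assumes "x \<in> unit_ideal"
  obtains c where "0 < c" "x \<le> c *\<^sub>R 1"
proof -
  define B :: "'l set" where "B = {x. \<exists>c>0. \<bar>x\<bar> \<le> c *\<^sub>R 1}"
  have "order_ideal B"
    unfolding order_ideal_def
  proof (intro conjI allI impI)
    show "subspace B"
    proof (rule subspaceI)
      show "0 \<in> B"
        unfolding B_def using f_algebra_one_ge_zero[where 'l='l] by (auto intro!: exI[of _ 1])
    next
      fix x y assume "x \<in> B" "y \<in> B"
      then obtain a b where "a > 0" "b > 0" "\<bar>x\<bar> \<le> a *\<^sub>R 1" "\<bar>y\<bar> \<le> b *\<^sub>R 1"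
        unfolding B_def by auto
      then have "\<bar>x + y\<bar> \<le> (a + b) *\<^sub>R 1"
        unfolding scaleR_left_distrib by (meson abs_triangle_ineq add_mono order_trans)
      with \<open>a > 0\<close> \<open>b > 0\<close> show "x + y \<in> B"
        unfolding B_def by (auto intro!: exI[of _ "a + b"])
    next
      fix r x assume "x \<in> B"
      then obtain a where a: "a > 0" "\<bar>x\<bar> \<le> a *\<^sub>R 1"
        unfolding B_def by auto
      have x: "x \<le> a *\<^sub>R 1" "- x \<le> a *\<^sub>R 1"
        using a(2) by (metis abs_ge_self order_trans, metis abs_ge_minus_self order_trans)
      \<comment> \<open>The summand 1 keeps the constant positive when \<open>r = 0\<close>.\<close>
      let ?c = "\<bar>r\<bar> * a + 1"
      have le: "\<bar>r\<bar> *\<^sub>R y \<le> ?c *\<^sub>R 1" if "y \<le> a *\<^sub>R 1" for y :: 'l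
      proof -
        have "\<bar>r\<bar> *\<^sub>R y \<le> (\<bar>r\<bar> * a) *\<^sub>R 1"
          using scaleR_left_mono[OF that, of "\<bar>r\<bar>"] by simp
        also have "\<dots> \<le> ?c *\<^sub>R 1"
          using f_algebra_one_ge_zero by (intro scaleR_right_mono) auto
        finally show ?thesis .
      qed
      have "r *\<^sub>R x \<le> ?c *\<^sub>R 1 \<and> - (r *\<^sub>R x) \<le> ?c *\<^sub>R 1"
        using le[OF x(1)] le[OF x(2)] by (cases "0 \<le> r") auto
      then have "\<bar>r *\<^sub>R x\<bar> \<le> ?c *\<^sub>R 1"
        by (simp add: abs_le_iff)
      moreover have "?c > 0"
        using a by (simp add: add_nonneg_pos)
      ultimately show "r *\<^sub>R x \<in> B"
        unfolding B_def by blast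
    qed
  next
    fix x y :: 'l assume "y \<in> B" "\<bar>x\<bar> \<le> \<bar>y\<bar>"
    then show "x \<in> B"
      unfolding B_def using order_trans by blast
  qed
  moreover have "{1} \<subseteq> B"
    unfolding B_def using f_algebra_one_ge_zero[where 'l='l]
    by (auto intro!: exI[of _ 1] simp: abs_of_nonneg)
  ultimately have "unit_ideal \<subseteq> B"
    unfolding unit_ideal_def by (intro hull_minimal)
  with assms obtain c where "c > 0" "\<bar>x\<bar> \<le> c *\<^sub>R 1"
    unfolding B_def by auto
  then show thesis
    using that by (meson abs_ge_self order_trans)
qed

lemma unit_ideal_pos_finite_boundedE:
  fixes V :: "'l::unital_f_algebra set"
  assumes "finite V" "V \<subseteq> unit_ideal_pos"
  obtains c where "0 < c" "\<And>v. v \<in> V \<Longrightarrow> v \<le> c *\<^sub>R 1"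
proof -
  have "\<exists>c>0. \<forall>v\<in>V. v \<le> c *\<^sub>R 1"
    using assms
  proof (induction V rule: finite_induct)
    case empty
    show ?case by (auto intro: exI[of _ 1])
  next
    case (insert x V)
    then obtain c where c: "c > 0" "\<forall>v\<in>V. v \<le> c *\<^sub>R 1" by auto
    from insert have "x \<in> unit_ideal" unfolding unit_ideal_pos_def by auto
    then obtain d where d: "d > 0" "x \<le> d *\<^sub>R 1" by (rule unit_ideal_boundedE)
    have "r *\<^sub>R (1::'l) \<le> max c d *\<^sub>R 1" if "r \<le> max c d" for r
      using that f_algebra_one_ge_zero by (intro scaleR_right_mono) auto
    from this[of c] this[of d] have "\<forall>v\<in>insert x V. v \<le> max c d *\<^sub>R 1"
      using c(2) d(2) by (auto intro: order_trans)
    then show ?case using c d by (intro exI[of _ "max c d"]) auto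
  qed
  with that show thesis by blast
qed

section \<open>Sequences decreasing to zero\<close>

lemma decreases_to_zero_iff:
  fixes x :: "nat \<Rightarrow> 'l::{zero, order}"
  shows "decreases_to_zero x \<longleftrightarrow>
    decseq x \<and> (\<forall>n. 0 \<le> x n) \<and> (\<forall>z. (\<forall>n. z \<le> x n) \<longrightarrow> z \<le> 0)"
  unfolding decreases_to_zero_def isGlb_def greatestP_def isLb_def setle_def setge_def
  by auto

lemma decreases_to_zero_add:
  fixes x y :: "nat \<Rightarrow> 'l::ordered_ab_group_add"
  assumes "decreases_to_zero x" "decreases_to_zero y"
  shows "decreases_to_zero (\<lambda>n. x n + y n)"
proof -
  have dx: "decseq x" and dy: "decseq y"
    using assms by (simp_all add: decreases_to_zero_iff)
  have "z \<le> 0" if z: "\<forall>n. z \<le> x n + y n" for z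
  proof -
    \<comment> \<open>Monotonicity decouples the two indices through \<open>max m n\<close>. The
      infimum can then be taken first over \<open>n\<close> and afterwards over
      \<open>m\<close>.\<close>
    have "z - y m \<le> x n" for m n
    proof -
      have "z \<le> x (max m n) + y (max m n)" using z by blast
      also have "\<dots> \<le> x n + y m"
        by (intro add_mono decseqD[OF dx] decseqD[OF dy]) auto
      finally show ?thesis by (simp add: algebra_simps)
    qed
    then have "z - y m \<le> 0" for m
      using assms(1) unfolding decreases_to_zero_iff by blast
    then show ?thesis
      using assms(2) by (simp add: decreases_to_zero_iff)
  qed
  moreover have "decseq (\<lambda>n. x n + y n)"
    using dx dy by (auto simp: decseq_def intro: add_mono)
  ultimately show ?thesis
    using assms by (auto simp: decreases_to_zero_iff)
qed

lemma decreases_to_zero_scaleR: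
  fixes x :: "nat \<Rightarrow> 'l::ordered_real_vector"
  assumes "decreases_to_zero x" "0 < c"
  shows "decreases_to_zero (\<lambda>n. c *\<^sub>R x n)"
proof -
  have "z \<le> 0" if z: "\<forall>n. z \<le> c *\<^sub>R x n" for z
  proof -
    have "inverse c *\<^sub>R z \<le> x n" for n
      using scaleR_left_mono[OF spec[OF z], of "inverse c" n] \<open>0 < c\<close> by simp
    then have "inverse c *\<^sub>R z \<le> 0"
      using assms(1) by (simp add: decreases_to_zero_iff)
    from scaleR_left_mono[OF this, of c] show ?thesis
      using \<open>0 < c\<close> by simp
  qed
  then show ?thesis
    using assms by (auto simp: decreases_to_zero_iff decseq_def intro: scaleR_left_mono scaleR_nonneg_nonneg)
qed

lemma decreases_to_zero_sum:
  fixes x :: "'i \<Rightarrow> nat \<Rightarrow> 'l::ordered_ab_group_add"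
  assumes "finite F" "\<And>i. i \<in> F \<Longrightarrow> decreases_to_zero (x i)"
  shows "decreases_to_zero (\<lambda>n. \<Sum>i\<in>F. x i n)"
  using assms
proof (induction F rule: finite_induct)
  case empty
  then show ?case by (simp add: decreases_to_zero_iff decseq_def)
next
  case (insert i F)
  then show ?case by (simp add: decreases_to_zero_add)
qed

lemma decreases_to_zero_minus_Inf:
  fixes x :: "nat \<Rightarrow> 'l::{ordered_ab_group_add, conditionally_complete_lattice}"
  assumes "decseq x" "\<And>n. 0 \<le> x n"
  shows "decreases_to_zero (\<lambda>n. x n - (INF n. x n))"
proof -
  have bdd: "bdd_below (range x)"
    using assms(2) by (rule bdd_belowI2)
  have "z \<le> 0" if "\<forall>n. z \<le> x n - (INF n. x n)" for z
  proof -
    have "z + (INF n. x n) \<le> x n" for n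
      using that by (simp add: algebra_simps)
    then have "z + (INF n. x n) \<le> (INF n. x n)"
      by (intro cINF_greatest) auto
    then show ?thesis by simp
  qed
  then show ?thesis
    using assms(1) cINF_lower[OF bdd]
    by (auto simp: decreases_to_zero_iff decseq_def diff_right_mono)
qed

text \<open>The Archimedean property, derived from Dedekind completeness: the infimum
  \<open>p\<close> satisfies \<open>p + p \<le> ?x n\<close> for all \<open>n\<close>, hence
  \<open>p\<close> is a lower bound of a sequence that decreases to zero.\<close>

lemma decreases_to_zero_inverse_scaleR:
  fixes u :: "'l::{ordered_real_vector, conditionally_complete_lattice}"
  assumes "0 \<le> u"
  shows "decreases_to_zero (\<lambda>n. inverse (real (Suc n)) *\<^sub>R u)"
proof -
  let ?x = "\<lambda>n. inverse (real (Suc n)) *\<^sub>R u"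
  define p where "p = (INF n. ?x n)"
  have dec: "decseq ?x"
    unfolding decseq_def using assms
    by (intro allI impI scaleR_right_mono le_imp_inverse_le) auto
  have pos: "0 \<le> ?x n" for n
    using assms by (intro scaleR_nonneg_nonneg) auto
  note dz = decreases_to_zero_minus_Inf[OF dec pos, folded p_def]
  have le: "p \<le> ?x n" for n
    using dz by (simp add: decreases_to_zero_iff)
  have "p \<le> ?x n - p" for n
  proof -
    \<comment> \<open>With the shift in the definition, index \<open>2 * n + 1\<close> has
      coefficient \<open>1 / (2 * n + 2)\<close>, exactly half of that at index
      \<open>n\<close>.\<close>
    have "p + p \<le> ?x (Suc (2 * n)) + ?x (Suc (2 * n))"
      by (intro add_mono le)
    also have "\<dots> = ?x n"
      by (simp add: scaleR_left_distrib[symmetric] field_simps)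
    finally show ?thesis by (simp add: algebra_simps)
  qed
  then have "p \<le> 0"
    using dz by (simp add: decreases_to_zero_iff)
  then have "z \<le> 0" if "\<forall>n. z \<le> ?x n" for z
    using that unfolding p_def by (meson cINF_greatest UNIV_not_empty order_trans)
  then show ?thesis
    using dec pos by (simp add: decreases_to_zero_iff)
qed

section \<open>Order continuous functionals on the ideal\<close>

text \<open>Passes from filters to sequences: the image filter of \<open>x\<close> is order null,
  with the range of the dominating sequence \<open>y\<close> as the downward directed set.\<close>

lemma order_continuous_functional_tendsto:
  fixes f :: "'l::{real_vector, lattice_ab_group_add_abs} \<Rightarrow> real"
  assumes "order_continuous_functional E f" "subspace E"
    and "\<And>n. x n \<in> E" "\<And>n. y n \<in> E"
    and "decreases_to_zero y" "\<And>n. \<bar>x n\<bar> \<le> y n"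
  shows "(\<lambda>n. f (x n)) \<longlonglongrightarrow> 0"
proof -
  have dec: "decseq y" using assms(5) by (simp add: decreases_to_zero_iff)
  have "order_null E (filtermap x sequentially)"
    unfolding order_null_def
  proof (intro conjI exI[of _ "range y"])
    show "\<forall>a\<in>range y. \<forall>b\<in>range y. \<exists>c\<in>range y. c \<le> a \<and> c \<le> b"
    proof clarify
      fix m n
      show "\<exists>c\<in>range y. c \<le> y m \<and> c \<le> y n"
        using decseqD[OF dec] by (intro bexI[of _ "y (max m n)"]) auto
    qed
    \<comment> \<open>An infimum in the whole space that belongs to \<open>E\<close> is also the
      infimum in \<open>E\<close>.\<close>
    show "isGlb E (range y) 0"
      using assms(5) subspace_0[OF assms(2)]
      by (auto simp: decreases_to_zero_iff isGlb_def greatestP_def isLb_def setle_def setge_def)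
    have "\<bar>x n\<bar> \<le> y k" if "k \<le> n" for n k
      using assms(6) decseqD[OF dec that] by (rule order_trans)
    then show "\<forall>d\<in>range y. \<forall>\<^sub>F x in filtermap x sequentially. \<bar>x\<bar> \<le> d"
      unfolding eventually_filtermap eventually_sequentially by blast
  qed (use assms(3,4) in \<open>auto simp: eventually_filtermap\<close>)
  then have "(f \<longlongrightarrow> 0) (filtermap x sequentially)"
    using assms(1) unfolding order_continuous_functional_def by blast
  then show ?thesis by (simp add: filterlim_filtermap)
qed

lemma order_continuous_functional_bounded:
  fixes f :: "'l::{unital_f_algebra, conditionally_complete_lattice} \<Rightarrow> real"
  assumes "order_continuous_functional unit_ideal f" "u \<in> unit_ideal" "0 \<le> u"
  obtains C where "\<And>x. 0 \<le> x \<Longrightarrow> x \<le> u \<Longrightarrow> \<bar>f x\<bar> \<le> C"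
proof -
  \<comment> \<open>If \<open>\<bar>f (x n)\<bar> > n + 1\<close> with \<open>0 \<le> x n \<le> u\<close>, then \<open>x n / (n + 1)\<close> is order null but its images stay away from 0.\<close>
  have "\<exists>C. \<forall>x. 0 \<le> x \<longrightarrow> x \<le> u \<longrightarrow> \<bar>f x\<bar> \<le> C"
  proof (rule ccontr)
    assume "\<nexists>C. \<forall>x. 0 \<le> x \<longrightarrow> x \<le> u \<longrightarrow> \<bar>f x\<bar> \<le> C"
    then have "\<forall>n. \<exists>x. 0 \<le> x \<and> x \<le> u \<and> real (Suc n) < \<bar>f x\<bar>"
      by (meson not_le)
    then obtain x where x: "\<And>n. 0 \<le> x n" "\<And>n. x n \<le> u" "\<And>n. real (Suc n) < \<bar>f (x n)\<bar>"
      by metis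
    let ?r = "\<lambda>n. inverse (real (Suc n))"
    have xE: "x n \<in> unit_ideal" for n
      using unit_ideal_downD[OF assms(2)] x by blast
    have "(\<lambda>n. f (?r n *\<^sub>R x n)) \<longlonglongrightarrow> 0"
    proof (rule order_continuous_functional_tendsto[OF assms(1) subspace_unit_ideal])
      show "?r n *\<^sub>R x n \<in> unit_ideal" "?r n *\<^sub>R u \<in> unit_ideal" for n
        using xE assms(2) by (auto intro: subspace_scale[OF subspace_unit_ideal])
      show "decreases_to_zero (\<lambda>n. ?r n *\<^sub>R u)"
        by (rule decreases_to_zero_inverse_scaleR[OF assms(3)])
      show "\<bar>?r n *\<^sub>R x n\<bar> \<le> ?r n *\<^sub>R u" for n
      proof -
        have "0 \<le> ?r n *\<^sub>R x n"
          using x(1) by (intro scaleR_nonneg_nonneg) auto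
        then show ?thesis
          using x(2) by (simp add: abs_of_nonneg scaleR_left_mono del: of_nat_Suc)
      qed
    qed
    then have "\<forall>\<^sub>F n in sequentially. \<bar>f (?r n *\<^sub>R x n)\<bar> < 1"
      by (auto simp: tendsto_iff dist_real_def)
    then obtain n where n: "\<bar>f (?r n *\<^sub>R x n)\<bar> < 1"
      unfolding eventually_sequentially by blast
    have "f (?r n *\<^sub>R x n) = ?r n * f (x n)"
      using assms(1) xE unfolding order_continuous_functional_def by blast
    then have "f (x n) = real (Suc n) * f (?r n *\<^sub>R x n)"
      by (simp del: of_nat_Suc)
    then have "\<bar>f (x n)\<bar> = real (Suc n) * \<bar>f (?r n *\<^sub>R x n)\<bar>"
      by (simp only: abs_mult abs_of_nat)
    also have "\<dots> < real (Suc n) * 1"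
      using n by (intro mult_strict_left_mono) auto
    finally have "\<bar>f (x n)\<bar> < real (Suc n)"
      by simp
    with x(3)[of n] show False by simp
  qed
  with that show thesis by blast
qed

lemma order_continuous_functional_sum:
  assumes "order_continuous_functional E f" "subspace E" "finite V" "\<And>v. v \<in> V \<Longrightarrow> g v \<in> E"
  shows "f (\<Sum>v\<in>V. g v) = (\<Sum>v\<in>V. f (g v))"
  using assms(3,4)
proof (induction V rule: finite_induct)
  case empty
  \<comment> \<open>Homogeneity with scalar 0 yields \<open>f 0 = 0\<close>.\<close>
  have "f (0 *\<^sub>R 0) = 0 * f 0"
    using assms(1) subspace_0[OF assms(2)] unfolding order_continuous_functional_def by blast
  then show ?case by simp
next
  case (insert v V)
  have "f (g v + (\<Sum>v\<in>V. g v)) = f (g v) + f (\<Sum>v\<in>V. g v)"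
    using assms(1) insert.prems subspace_sum[OF assms(2), of V g]
    unfolding order_continuous_functional_def by blast
  with insert show ?case by simp
qed

section \<open>Additive set functions and integrals of step functions\<close>

lemma additive_finite_Union:
  fixes \<nu> :: "'s set \<Rightarrow> 'l::comm_monoid_add"
  assumes "additive (sets M) \<nu>" "\<nu> {} = 0"
    and "finite I" "\<And>i. i \<in> I \<Longrightarrow> A i \<in> sets M" "disjoint_family_on A I"
  shows "\<nu> (\<Union>i\<in>I. A i) = (\<Sum>i\<in>I. \<nu> (A i))"
  using assms(3-5)
proof (induction I rule: finite_induct)
  case empty
  then show ?case by (simp add: assms(2))
next
  case (insert i I)
  have A: "\<And>j. j \<in> insert i I \<Longrightarrow> A j \<in> sets M"
    by (rule insert.prems(1))
  have disj: "A i \<inter> (\<Union>i\<in>I. A i) = {}" and disj_I: "disjoint_family_on A I"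
    using disjoint_family_on_insert[OF insert.hyps(2), of A] insert.prems(2) by simp_all
  have "\<nu> (A i \<union> (\<Union>i\<in>I. A i)) = \<nu> (A i) + \<nu> (\<Union>i\<in>I. A i)"
    using insert.hyps(1) A by (intro additiveD[OF assms(1) disj] sets.finite_UN) auto
  also have "\<nu> (\<Union>i\<in>I. A i) = (\<Sum>i\<in>I. \<nu> (A i))"
    using A disj_I by (intro insert.IH) simp_all
  finally show ?case
    using insert.hyps by simp
qed

text \<open>The sequence \<open>A, B, {}, {}, ...\<close> turns countable additivity into the finite
  one: every finite partial sum is at most \<open>\<mu> A + \<mu> B\<close>, and the index set
  \<open>{0, 1}\<close> attains this bound, so it is the supremum.\<close>

lemma vector_measure_additive:
  fixes \<mu> :: "'s set \<Rightarrow> 'l::ordered_ab_group_add"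
  assumes "vector_measure M \<mu>"
  shows "additive (sets M) \<mu>"
  unfolding additive_def
proof (intro ballI impI)
  fix A B assume AB: "A \<in> sets M" "B \<in> sets M" "A \<inter> B = {}"
  let ?b = "\<lambda>n. \<mu> (binaryset A B n)"
  have two: "sum ?b {0, 1} = \<mu> A + \<mu> B"
    by (simp add: binaryset_def)
  have "range (binaryset A B) \<subseteq> sets M"
    using AB by (auto simp: range_binaryset_eq)
  moreover have "disjoint_family (binaryset A B)"
    using AB by (auto simp: disjoint_family_on_def binaryset_def)
  ultimately have lub: "isLub UNIV {sum ?b F | F. finite F \<and> F \<subseteq> UNIV} (\<mu> (A \<union> B))"
    using assms unfolding vector_measure_def has_order_sum_in_def UN_binaryset_eq[symmetric]
    by blast
  have "sum ?b F \<le> \<mu> A + \<mu> B" if "finite F" for F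
  proof -
    have "0 \<le> ?b n" for n
      using assms AB unfolding vector_measure_def by (auto simp: binaryset_def)
    then have "sum ?b F \<le> sum ?b (F \<union> {0, 1})"
      using that by (intro sum_mono2) auto
    also have "\<dots> = sum ?b {0, 1}"
      using that assms by (intro sum.mono_neutral_right) (auto simp: binaryset_def vector_measure_def)
    finally show ?thesis by (simp only: two)
  qed
  then have "\<mu> (A \<union> B) \<le> \<mu> A + \<mu> B"
    by (intro isLub_le_isUb[OF lub] isUb_UNIV_I) auto
  moreover have "\<mu> A + \<mu> B \<le> \<mu> (A \<union> B)"
    using two by (intro isLubD2[OF lub]) (auto intro!: exI[of _ "{0, 1::nat}"])
  ultimately show "\<mu> (A \<union> B) = \<mu> A + \<mu> B"
    by simp
qed

lemma additive_simple_function_partition: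
  fixes \<nu> :: "'s set \<Rightarrow> 'l::comm_monoid_add"
  assumes "additive (sets M) \<nu>" "\<nu> {} = 0" "simple_function M \<phi>" "A \<in> sets M"
  shows "\<nu> A = (\<Sum>v\<in>\<phi> ` space M. \<nu> (A \<inter> (\<phi> -` {v} \<inter> space M)))"
proof -
  have "A = (\<Union>v\<in>\<phi> ` space M. A \<inter> (\<phi> -` {v} \<inter> space M))"
    using sets.sets_into_space[OF assms(4)] by auto
  also have "\<nu> \<dots> = (\<Sum>v\<in>\<phi> ` space M. \<nu> (A \<inter> (\<phi> -` {v} \<inter> space M)))"
    using simple_functionD[OF assms(3)] assms(4)
    by (intro additive_finite_Union[OF assms(1,2)]) (auto simp: disjoint_family_on_def)
  finally show ?thesis .
qed

text \<open>Both integrals are expanded over the common refinement of the two level set partitions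
  and compared cell by cell.\<close>

lemma step_integral_mono:
  fixes \<nu> :: "'s set \<Rightarrow> 'l::ordered_ring"
  assumes add: "additive (sets M) \<nu>" "\<nu> {} = 0" and nonneg: "\<And>A. A \<in> sets M \<Longrightarrow> 0 \<le> \<nu> A"
    and \<phi>: "simple_function M \<phi>" and \<psi>: "simple_function M \<psi>"
    and le: "\<And>s. s \<in> space M \<Longrightarrow> \<phi> s \<le> \<psi> s"
  shows "step_integral M \<nu> \<phi> \<le> step_integral M \<nu> \<psi>"
proof -
  let ?A = "\<lambda>v. \<phi> -` {v} \<inter> space M" and ?B = "\<lambda>w. \<psi> -` {w} \<inter> space M"
  have A: "?A v \<in> sets M" and B: "?B v \<in> sets M" for v
    using simple_functionD[OF \<phi>] simple_functionD[OF \<psi>] by auto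
  have "step_integral M \<nu> \<phi> = (\<Sum>v\<in>\<phi> ` space M. \<Sum>w\<in>\<psi> ` space M. v * \<nu> (?A v \<inter> ?B w))"
    unfolding step_integral_def
    by (intro sum.cong refl, subst additive_simple_function_partition[OF add \<psi> A])
       (simp add: sum_distrib_left)
  also have "\<dots> \<le> (\<Sum>v\<in>\<phi> ` space M. \<Sum>w\<in>\<psi> ` space M. w * \<nu> (?A v \<inter> ?B w))"
  proof (intro sum_mono)
    fix v w
    show "v * \<nu> (?A v \<inter> ?B w) \<le> w * \<nu> (?A v \<inter> ?B w)"
    \<comment> \<open>Only a nonempty cell contains a point witnessing \<open>v \<le> w\<close>; on
      an empty cell both terms vanish.\<close>
    proof (cases "?A v \<inter> ?B w = {}")
      case True
      then show ?thesis by (simp only: add(2) mult_zero_right)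
    next
      case False
      then have "v \<le> w" using le by auto
      then show ?thesis using A B by (intro mult_right_mono nonneg) auto
    qed
  qed
  also have "\<dots> = (\<Sum>w\<in>\<psi> ` space M. \<Sum>v\<in>\<phi> ` space M. w * \<nu> (?B w \<inter> ?A v))"
    by (subst sum.swap) (simp only: Int_commute)
  also have "\<dots> = step_integral M \<nu> \<psi>"
    unfolding step_integral_def
    by (intro sum.cong refl, subst additive_simple_function_partition[OF add \<phi> B])
       (simp add: sum_distrib_left)
  finally show ?thesis .
qed

lemma step_integral_nonneg:
  fixes \<nu> :: "'s set \<Rightarrow> 'l::ordered_ring"
  assumes "\<And>A. A \<in> sets M \<Longrightarrow> 0 \<le> \<nu> A" "simple_function M \<phi>" "\<And>s. s \<in> space M \<Longrightarrow> 0 \<le> \<phi> s"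
  shows "0 \<le> step_integral M \<nu> \<phi>"
  unfolding step_integral_def using assms(1,3) simple_functionD[OF assms(2)]
  by (intro sum_nonneg mult_nonneg_nonneg) auto

text \<open>Each value is replaced by \<open>c *\<^sub>R 1\<close>, which acts as the real scalar
  \<open>c\<close>; the level sets then add up to the whole space. This estimate controls the
  remainder of the measure uniformly in the step functions.\<close>

lemma step_integral_le_scaleR:
  fixes \<nu> :: "'s set \<Rightarrow> 'l::unital_f_algebra"
  assumes add: "additive (sets M) \<nu>" "\<nu> {} = 0" and nonneg: "\<And>A. A \<in> sets M \<Longrightarrow> 0 \<le> \<nu> A"
    and \<phi>: "simple_function M \<phi>" and le: "\<And>s. s \<in> space M \<Longrightarrow> \<phi> s \<le> c *\<^sub>R 1"
  shows "step_integral M \<nu> \<phi> \<le> c *\<^sub>R \<nu> (space M)"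
proof -
  let ?A = "\<lambda>v. \<phi> -` {v} \<inter> space M"
  have "step_integral M \<nu> \<phi> \<le> (\<Sum>v\<in>\<phi> ` space M. (c *\<^sub>R 1) * \<nu> (?A v))"
    unfolding step_integral_def using le simple_functionD[OF \<phi>]
    by (intro sum_mono mult_right_mono nonneg) auto
  also have "\<dots> = c *\<^sub>R (\<Sum>v\<in>\<phi> ` space M. \<nu> (space M \<inter> ?A v))"
    by (simp add: scaleR_sum_right Int_absorb1)
  also have "\<dots> = c *\<^sub>R \<nu> (space M)"
    using additive_simple_function_partition[OF add \<phi> sets.top] by simp
  finally show ?thesis .
qed

section \<open>Integration against a single real measure\<close>

text \<open>With the unit as vector factor, the step integral is a finite real combination of the
  values of \<open>\<phi>\<close>, so linearity moves \<open>f\<close> inside.\<close>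

lemma order_continuous_functional_step_integral:
  fixes f :: "'l::unital_f_algebra \<Rightarrow> real"
  assumes f: "order_continuous_functional unit_ideal f"
    and \<phi>: "simple_function M \<phi>" "\<phi> ` space M \<subseteq> unit_ideal"
    and m: "finite_measure m" "space m = space M" "sets m = sets M"
  shows "f (step_integral M (\<lambda>A. measure m A *\<^sub>R 1) \<phi>) = (\<integral>s. f (\<phi> s) \<partial>m)"
proof -
  interpret finite_measure m by (rule m(1))
  let ?A = "\<lambda>v. \<phi> -` {v} \<inter> space M"
  have A: "?A v \<in> sets m" for v
    using simple_functionD[OF \<phi>(1)] m by auto
  have fin: "finite (\<phi> ` space M)"
    using simple_functionD[OF \<phi>(1)] by auto
  have "(\<integral>s. f (\<phi> s) \<partial>m) = (\<integral>s. (\<Sum>v\<in>\<phi> ` space M. f v * indicator (?A v) s) \<partial>m)"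
  proof (rule Bochner_Integration.integral_cong[OF refl])
    fix s assume s: "s \<in> space m"
    have "(\<Sum>v\<in>\<phi> ` space M. f v * indicator (?A v) s) = (\<Sum>v\<in>\<phi> ` space M. if v = \<phi> s then f v else 0)"
      using s m by (intro sum.cong) (auto simp: indicator_def)
    then show "f (\<phi> s) = (\<Sum>v\<in>\<phi> ` space M. f v * indicator (?A v) s)"
      using fin s m by simp
  qed
  also have "\<dots> = (\<Sum>v\<in>\<phi> ` space M. f v * measure m (?A v))"
    using A sets.Int_space_eq2[OF A]
    by (subst Bochner_Integration.integral_sum) (auto simp: emeasure_eq_measure)
  also have "\<dots> = (\<Sum>v\<in>\<phi> ` space M. f (measure m (?A v) *\<^sub>R v))"
    using f \<phi>(2) unfolding order_continuous_functional_def
    by (intro sum.cong refl) (auto simp: mult.commute)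
  also have "\<dots> = f (\<Sum>v\<in>\<phi> ` space M. measure m (?A v) *\<^sub>R v)"
    using \<phi>(2) fin
    by (intro order_continuous_functional_sum[OF f subspace_unit_ideal, symmetric])
       (auto intro: subspace_scale[OF subspace_unit_ideal])
  finally show ?thesis
    unfolding step_integral_def by simp
qed

lemma decreases_to_zero_scalar_step_integral:
  fixes \<phi> :: "nat \<Rightarrow> 's \<Rightarrow> 'l::{unital_f_algebra, conditionally_complete_lattice}"
  assumes sep: "order_continuous_functionals_separate (unit_ideal :: 'l set)"
    and m: "finite_measure m" "space m = space M" "sets m = sets M"
    and \<phi>: "\<And>n. \<phi> n \<in> step_functions M unit_ideal_pos"
    and dec: "\<And>s. s \<in> space M \<Longrightarrow> decreases_to_zero (\<lambda>n. \<phi> n s)"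
  shows "decreases_to_zero (\<lambda>n. step_integral M (\<lambda>A. measure m A *\<^sub>R 1) (\<phi> n))"
proof -
  interpret finite_measure m by (rule m(1))
  let ?\<nu> = "\<lambda>A. measure m A *\<^sub>R (1::'l)"
  define x where "x = (\<lambda>n. step_integral M ?\<nu> (\<phi> n))"
  have add: "additive (sets M) ?\<nu>" "?\<nu> {} = 0"
    using m(3) by (auto simp: additive_def finite_measure_Union scaleR_left_distrib)
  have nonneg: "0 \<le> ?\<nu> A" for A
    using f_algebra_one_ge_zero by (intro scaleR_nonneg_nonneg) auto
  have simple: "simple_function M (\<phi> n)" and pos: "\<phi> n ` space M \<subseteq> unit_ideal_pos" for n
    using \<phi> unfolding step_functions_def by auto
  have E: "\<phi> n s \<in> unit_ideal" "0 \<le> \<phi> n s" if "s \<in> space M" for n s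
    using pos[of n] that unfolding unit_ideal_pos_def by auto
  have fin: "finite (\<phi> n ` space M)" for n
    using simple_functionD(1)[OF simple] .
  have "decseq x"
    unfolding x_def decseq_def using dec
    by (intro allI impI step_integral_mono[OF add nonneg simple simple])
       (auto simp: decreases_to_zero_iff decseq_def)
  moreover have x_nonneg: "0 \<le> x n" for n
    unfolding x_def using E by (intro step_integral_nonneg nonneg simple)
  ultimately have dz: "decreases_to_zero (\<lambda>n. x n - (INF n. x n))"
    by (rule decreases_to_zero_minus_Inf)
  define p where "p = (INF n. x n)"
  have p: "0 \<le> p" "\<And>n. p \<le> x n"
    unfolding p_def using x_nonneg dz
    by (auto intro: cINF_greatest simp: decreases_to_zero_iff)
  \<comment> \<open>Membership in the ideal is needed because the linearity and continuity of a
    functional are known only there.\<close>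
  have xE: "x n \<in> unit_ideal" for n
  proof -
    have "x n = (\<Sum>v\<in>\<phi> n ` space M. measure m (\<phi> n -` {v} \<inter> space M) *\<^sub>R v)"
      unfolding x_def step_integral_def by simp
    also have "\<dots> \<in> unit_ideal"
      using E by (intro subspace_sum subspace_scale subspace_unit_ideal) auto
    finally show ?thesis .
  qed
  have pE: "p \<in> unit_ideal"
    using unit_ideal_downD[OF xE p] .
  have "p = 0"
  proof (rule ccontr)
    assume "p \<noteq> 0"
    then obtain f where f: "order_continuous_functional (unit_ideal :: 'l set) f" "f p \<noteq> f 0"
      using sep pE subspace_0[OF subspace_unit_ideal]
      unfolding order_continuous_functionals_separate_def by blast
    \<comment> \<open>A bound for \<open>\<phi> 0\<close> bounds every \<open>\<phi> n\<close>,
      because the sequence decreases. Boundedness of \<open>f\<close> on the interval from 0 to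
      \<open>c *\<^sub>R 1\<close> then supplies the constant dominating function.\<close>
    obtain c where c: "0 < c" "\<And>v. v \<in> \<phi> 0 ` space M \<Longrightarrow> v \<le> c *\<^sub>R 1"
      using unit_ideal_pos_finite_boundedE[OF fin pos] by blast
    have c1: "c *\<^sub>R (1::'l) \<in> unit_ideal"
    proof (rule subspace_scale[OF subspace_unit_ideal])
      show "(1::'l) \<in> unit_ideal"
        unfolding unit_ideal_def by (rule hull_inc) simp
    qed
    have "0 \<le> c *\<^sub>R (1::'l)"
      using c(1) f_algebra_one_ge_zero by (intro scaleR_nonneg_nonneg) auto
    then obtain C where C: "\<And>x. 0 \<le> x \<Longrightarrow> x \<le> c *\<^sub>R 1 \<Longrightarrow> \<bar>f x\<bar> \<le> C"
      using order_continuous_functional_bounded[OF f(1) c1] by blast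
    have "(\<lambda>n. \<integral>s. f (\<phi> n s) \<partial>m) \<longlonglongrightarrow> (\<integral>s. 0 \<partial>m)"
    proof (rule integral_dominated_convergence[where w = "\<lambda>_. C"])
      show "(\<lambda>s. f (\<phi> n s)) \<in> borel_measurable m" for n
      proof -
        \<comment> \<open>Nothing is known about measurability of \<open>f\<close> itself, but its
          composition with a simple function is again simple. The second argument of the binary
          composition is a dummy.\<close>
        have "simple_function m (\<phi> n)"
          using simple[of n] m by (simp add: simple_function_def)
        from simple_function_compose2[OF this this, of "\<lambda>a b. f a"] show ?thesis
          by (rule borel_measurable_simple_function)
      qed
      show "AE s in m. (\<lambda>n. f (\<phi> n s)) \<longlonglongrightarrow> 0"
      proof (rule AE_I2)
        fix s assume "s \<in> space m"
        then have s: "s \<in> space M" by (simp add: m(2))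
        show "(\<lambda>n. f (\<phi> n s)) \<longlonglongrightarrow> 0"
          by (rule order_continuous_functional_tendsto[OF f(1) subspace_unit_ideal _ _ dec[OF s]])
             (use E s in \<open>auto simp: abs_of_nonneg\<close>)
      qed
      show "AE s in m. norm (f (\<phi> n s)) \<le> C" for n
      proof (rule AE_I2)
        fix s assume "s \<in> space m"
        then have s: "s \<in> space M" by (simp add: m(2))
        have "\<phi> n s \<le> \<phi> 0 s"
          using dec[OF s] by (auto simp: decreases_to_zero_iff decseq_def)
        also have "\<dots> \<le> c *\<^sub>R 1"
          using c(2) s by blast
        finally show "norm (f (\<phi> n s)) \<le> C"
          using C E s by simp
      qed
    qed auto
    moreover have "(\<integral>s. f (\<phi> n s) \<partial>m) = f (x n)" for n
      unfolding x_def using E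
      by (intro order_continuous_functional_step_integral[OF f(1) simple _ m, symmetric]) auto
    ultimately have "(\<lambda>n. f (x n)) \<longlonglongrightarrow> 0"
      by simp
    moreover have "(\<lambda>n. f (x n - p)) \<longlonglongrightarrow> 0"
      by (rule order_continuous_functional_tendsto[OF f(1) subspace_unit_ideal _ _ dz[folded p_def]])
         (use p xE pE in \<open>auto simp: abs_of_nonneg intro: subspace_diff[OF subspace_unit_ideal]\<close>)
    moreover have "f (x n) = f (x n - p) + f p" for n
    proof -
      have "f ((x n - p) + p) = f (x n - p) + f p"
        using f(1) pE subspace_diff[OF subspace_unit_ideal xE pE]
        unfolding order_continuous_functional_def by blast
      then show ?thesis by simp
    qed
    \<comment> \<open>The same sequence \<open>f (x n)\<close> tends to 0 by dominated convergence
      and to \<open>f p\<close> by order continuity.\<close>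
    ultimately have "(\<lambda>n. f (x n - p) + f p) \<longlonglongrightarrow> 0" "(\<lambda>n. f (x n - p) + f p) \<longlonglongrightarrow> 0 + f p"
      by (simp, intro tendsto_add tendsto_const)
    then have "f p = 0"
      using LIMSEQ_unique by fastforce
    moreover have "f 0 = 0"
      using order_continuous_functional_sum[OF f(1) subspace_unit_ideal, of "{}"] by simp
    ultimately show False
      using f(2) by simp
  qed
  then show ?thesis
    using dz unfolding p_def[symmetric] by (simp add: x_def)
qed

section \<open>Finite partial sums of scalar measures and the positive remainder\<close>

theorem theorem4p4:
  fixes M :: "'s measure"
    and \<mu> :: "'s set \<Rightarrow> 'l::{unital_f_algebra, conditionally_complete_lattice}"
  assumes "vector_measure M \<mu>"
    and "sigma_scalar TYPE('j) M \<mu>"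
    and "order_continuous_functionals_separate (unit_ideal :: 'l set)"
  shows "proper_measure M \<mu>"
  unfolding proper_measure_def
proof (intro allI impI)
  fix \<phi> :: "nat \<Rightarrow> 's \<Rightarrow> 'l"
  assume \<phi>: "\<forall>n. \<phi> n \<in> step_functions M unit_ideal_pos"
    and dec: "\<forall>s\<in>space M. decreases_to_zero (\<lambda>n. \<phi> n s)"
  from assms(2) obtain J :: "'j set" and m :: "'j \<Rightarrow> 's measure" and lam :: "'j \<Rightarrow> 'l" where
    \<mu>E: "\<mu> ` sets M \<subseteq> unit_ideal"
    and m': "\<forall>j\<in>J. finite_measure (m j) \<and> space (m j) = space M \<and> sets (m j) = sets M"
    and lam': "\<forall>j\<in>J. lam j \<in> unit_ideal_pos"
    and lub': "\<forall>A\<in>sets M. has_order_sum_in unit_ideal (\<lambda>j. measure (m j) A *\<^sub>R lam j) J (\<mu> A)"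
    unfolding sigma_scalar_def by (elim conjE exE)
  have m: "finite_measure (m j)" "space (m j) = space M" "sets (m j) = sets M"
    and lam: "lam j \<in> unit_ideal_pos" if "j \<in> J" for j
    using m' lam' that by auto
  have lub: "isLub unit_ideal {sum (\<lambda>j. measure (m j) A *\<^sub>R lam j) F | F. finite F \<and> F \<subseteq> J} (\<mu> A)"
    if "A \<in> sets M" for A
    using bspec[OF lub' that] unfolding has_order_sum_in_def .
  note add = vector_measure_additive[OF assms(1)]
  have empty: "\<mu> {} = 0" and nonneg: "\<And>A. A \<in> sets M \<Longrightarrow> 0 \<le> \<mu> A"
    using assms(1) unfolding vector_measure_def by auto
  have simple: "simple_function M (\<phi> n)" and pos: "\<phi> n ` space M \<subseteq> unit_ideal_pos" for n
    using \<phi> unfolding step_functions_def by auto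
  have \<phi>_nonneg: "0 \<le> \<phi> n s" if "s \<in> space M" for n s
    using pos[of n] that unfolding unit_ideal_pos_def by auto
  have anti: "\<phi> n s \<le> \<phi> k s" if "s \<in> space M" "k \<le> n" for n k s
    using dec that by (auto simp: decreases_to_zero_iff decseq_def)
  obtain c where c: "0 < c" "\<And>v. v \<in> \<phi> 0 ` space M \<Longrightarrow> v \<le> c *\<^sub>R 1"
    using unit_ideal_pos_finite_boundedE[OF simple_functionD(1)[OF simple] pos] by blast
  have bound: "\<phi> n s \<le> c *\<^sub>R 1" if "s \<in> space M" for n s
    using anti[OF that, of 0 n] c(2)[of "\<phi> 0 s"] that by auto
  let ?x = "\<lambda>n. step_integral M \<mu> (\<phi> n)"
  have x_nonneg: "0 \<le> ?x n" for n
    using \<phi>_nonneg nonneg by (intro step_integral_nonneg simple)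
  have "decseq ?x"
    unfolding decseq_def using anti
    by (intro allI impI step_integral_mono[OF add empty nonneg simple simple]) auto
  moreover have "z \<le> 0" if z: "\<forall>n. z \<le> ?x n" for z
  proof -
    \<comment> \<open>The positive part is still a lower bound, as the integrals are positive.
      Unlike \<open>z\<close>, it can be shown to lie in the ideal, by domination.\<close>
    define y where "y = sup z 0"
    have y: "0 \<le> y" "\<And>n. y \<le> ?x n"
      unfolding y_def using z x_nonneg by auto
    let ?\<mu> = "\<lambda>F A. \<Sum>j\<in>F. measure (m j) A *\<^sub>R lam j"
    have le: "y \<le> c *\<^sub>R (\<mu> (space M) - ?\<mu> F (space M))" if F: "finite F" "F \<subseteq> J" for F
    proof -
      let ?\<rho> = "\<lambda>A. \<mu> A - ?\<mu> F A"
      have "\<forall>j\<in>F. \<exists>d>0. lam j \<le> d *\<^sub>R 1"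
      proof
        fix j assume "j \<in> F"
        then have "lam j \<in> unit_ideal" using lam F unfolding unit_ideal_pos_def by auto
        then show "\<exists>d>0. lam j \<le> d *\<^sub>R 1" by (metis unit_ideal_boundedE)
      qed
      \<comment> \<open>Bounding \<open>lam j\<close> by a multiple of the unit replaces the right
        factor \<open>lam j\<close> by the real scalar \<open>d j\<close>, which reduces each term
        to the case of one real measure.\<close>
      then obtain d where d: "\<And>j. j \<in> F \<Longrightarrow> 0 < d j \<and> lam j \<le> d j *\<^sub>R 1"
        by metis
      let ?X = "\<lambda>j n. step_integral M (\<lambda>A. measure (m j) A *\<^sub>R 1) (\<phi> n)"
      have "additive (sets M) (?\<mu> F)"
        unfolding additive_def
      proof (intro ballI impI)
        fix A B assume "A \<in> sets M" "B \<in> sets M" "A \<inter> B = {}"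
        then have "measure (m j) (A \<union> B) = measure (m j) A + measure (m j) B" if "j \<in> F" for j
          using m F that by (auto intro!: finite_measure.finite_measure_Union)
        then show "?\<mu> F (A \<union> B) = ?\<mu> F A + ?\<mu> F B"
          by (simp add: scaleR_left_distrib sum.distrib)
      qed
      with add have \<rho>: "additive (sets M) ?\<rho>" "?\<rho> {} = 0"
        using empty by (auto simp: additive_def)
      \<comment> \<open>A finite partial sum lies below the supremum of all of them.\<close>
      have \<rho>_nonneg: "0 \<le> ?\<rho> A" if "A \<in> sets M" for A
        using isLubD2[OF lub[OF that], of "?\<mu> F A"] F by auto
      have "y \<le> (\<Sum>j\<in>F. d j *\<^sub>R ?X j n) + c *\<^sub>R ?\<rho> (space M)" for n
      proof -
        let ?A = "\<lambda>v. \<phi> n -` {v} \<inter> space M"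
        have "?x n = step_integral M (?\<mu> F) (\<phi> n) + step_integral M ?\<rho> (\<phi> n)"
          unfolding step_integral_def by (simp add: sum.distrib[symmetric] distrib_left[symmetric])
        also have "step_integral M (?\<mu> F) (\<phi> n) = (\<Sum>j\<in>F. ?X j n * lam j)"
          unfolding step_integral_def
          by (simp add: sum_distrib_left sum_distrib_right) (rule sum.swap)
        also have "\<dots> \<le> (\<Sum>j\<in>F. d j *\<^sub>R ?X j n)"
        proof (rule sum_mono)
          fix j assume j: "j \<in> F"
          have "0 \<le> ?X j n"
            using \<phi>_nonneg f_algebra_one_ge_zero
            by (intro step_integral_nonneg simple scaleR_nonneg_nonneg) auto
          then have "?X j n * lam j \<le> ?X j n * (d j *\<^sub>R 1)"
            using d[OF j] by (intro mult_left_mono) auto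
          then show "?X j n * lam j \<le> d j *\<^sub>R ?X j n" by simp
        qed
        also have "step_integral M ?\<rho> (\<phi> n) \<le> c *\<^sub>R ?\<rho> (space M)"
          using bound by (intro step_integral_le_scaleR \<rho> \<rho>_nonneg simple)
        finally show ?thesis
          using y(2)[of n] by (simp add: order_trans)
      qed
      \<comment> \<open>With \<open>F\<close> fixed, the left side is independent of
        \<open>n\<close>, while the finite sum on the right decreases to zero.\<close>
      then have "y - c *\<^sub>R ?\<rho> (space M) \<le> (\<Sum>j\<in>F. d j *\<^sub>R ?X j n)" for n
        by (simp add: diff_le_eq)
      moreover have "decreases_to_zero (\<lambda>n. \<Sum>j\<in>F. d j *\<^sub>R ?X j n)"
        using F d dec \<phi> m
        by (intro decreases_to_zero_sum decreases_to_zero_scaleR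
              decreases_to_zero_scalar_step_integral[OF assms(3)]) auto
      ultimately have "y - c *\<^sub>R ?\<rho> (space M) \<le> 0"
        unfolding decreases_to_zero_iff by blast
      then show ?thesis by simp
    qed
    \<comment> \<open>The infimum over \<open>F\<close> in supremum form: by \<open>le\<close>, the
      right side is an upper bound of all partial sums, so it dominates their supremum
      \<open>\<mu> (space M)\<close>.\<close>
    have "\<mu> (space M) \<le> \<mu> (space M) - inverse c *\<^sub>R y"
    proof (rule isLub_le_isUb[OF lub[OF sets.top]], rule isUbI)
      show "{?\<mu> F (space M) | F. finite F \<and> F \<subseteq> J} *<= (\<mu> (space M) - inverse c *\<^sub>R y)"
      proof (rule setleI, clarify)
        fix F assume "finite F" "F \<subseteq> J"
        from scaleR_left_mono[OF le[OF this], of "inverse c"] c(1)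
        show "?\<mu> F (space M) \<le> \<mu> (space M) - inverse c *\<^sub>R y"
          by (simp add: algebra_simps)
      qed
      have \<mu>S: "\<mu> (space M) \<in> unit_ideal" using \<mu>E by auto
      \<comment> \<open>The supremum is taken within the ideal, so the upper bound must belong to
        it. The empty \<open>F\<close> gives \<open>y \<le> c *\<^sub>R \<mu> (space M)\<close>,
        which suffices.\<close>
      have "y \<in> unit_ideal"
        using unit_ideal_downD[OF subspace_scale[OF subspace_unit_ideal \<mu>S, of c] y(1)]
          le[of "{}"] by simp
      then show "\<mu> (space M) - inverse c *\<^sub>R y \<in> unit_ideal"
        using \<mu>S by (intro subspace_diff subspace_scale subspace_unit_ideal)
    qed
    then have "inverse c *\<^sub>R y \<le> 0" by simp
    from scaleR_left_mono[OF this, of c] c(1) have "y \<le> 0" by simp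
    then show "z \<le> 0" unfolding y_def by simp
  qed
  ultimately show "decreases_to_zero ?x"
    using x_nonneg by (simp add: decreases_to_zero_iff)
qed

end
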